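(* Let $\alpha\in\mathrm{Class}(0)$ and $t\in[\alpha,\alpha\omega)$. If $\alpha<^0t+1$, then $\alpha\in\mathrm{Lim}\{\beta\in\mathrm{Class}(0): T(0,\alpha,t)\cap\alpha\subset\beta \text{ and } \beta\le_1 g(0,\alpha,\beta)(t)\}$.
   Context: All variables range over ordinals; each ordinal is identified with the set of smaller ordinals, so for a set $S$ of ordinals and an ordinal $\beta$, $S\subset\beta$ means that all elements of $S$ are $<\beta$. Sums and products are ordinal operations. $\mathrm{Class}(0):=\mathbb{P}=\{\omega^\gamma:\gamma>0\}$ is the class of additive principal ordinals. For a class $A$ of ordinals, $\mathrm{Lim}\,A:=\{\alpha\neq 0:\alpha=\sup(A\cap\alpha)\}$. For $\alpha\le\beta$, $-\alpha+\beta$ is the unique $\sigma$ with $\alpha+\sigma=\beta$. The relation $<_1$. By recursion on $\beta$: $\alpha<_1\beta$ iff $\alpha<\beta$ and for every finite $Z\subset\beta$ there are a finite $\tilde Z\subset\alpha$ and a $(<,<_1,+)$-isomorphism $h:Z\to\tilde Z$ with $h(x)=x$ for all $x\in Z\cap\alpha$. Here a $(<,<_1,+)$-isomorphism $h:Z\to\tilde Z$ between sets of ordinals is a bijection such that for all $a_1,a_2\in Z$: $a_1<a_2\Leftrightarrow h(a_1)<h(a_2)$; $a_1<_1a_2\Leftrightarrow h(a_1)<_1h(a_2)$; $a_1+a_2\in Z\Leftrightarrow h(a_1)+h(a_2)\in\tilde Z$; and if $a_1+a_2\in Z$ then $h(a_1+a_2)=h(a_1)+h(a_2)$. $\alpha\le_1\beta$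 means $\alpha<_1\beta$ or $\alpha=\beta$. The maps $g(0,\alpha,c)$. For $\alpha,c\in\mathrm{Class}(0)$ with $\alpha\le c$, $g(0,\alpha,c):\alpha\omega\to c\omega$ is defined by $g(0,\alpha,c)(x)=x$ if $x<\alpha$, and $g(0,\alpha,c)(\alpha n+l)=cn+l$ for $n\in[1,\omega)$, $l<\alpha$. Moreover $g(0,c,\alpha):=g(0,\alpha,c)^{-1}$, with domain the image of $g(0,\alpha,c)$. The sets $T$. For $\alpha\in\mathrm{Class}(0)$ and $t<\alpha\omega$: $T(0,\alpha,t):=\{t\}$ if $t<\alpha$, and $T(0,\alpha,t):=\{t,-\alpha n+t\}$ if $t\in[\alpha n,\alpha n+\alpha)$ with $n\in[1,\omega)$. The relation $<^0$. For $\alpha\in\mathrm{Class}(0)$ and $t\in[\alpha,\alpha\omega]$, $\alpha<^0t$ means: $\alpha<t$ and for every finite $B\subset t$ there is $\delta\in\mathrm{Class}(0)\cap\alpha$ such that (i) $\left(\bigcup_{q\in B}T(0,\alpha,q)\right)\cap\alpha\subset\delta$, and (ii) the function $h:B\to h[B]$, $h(x):=g(0,\alpha,\delta)(x)$, is a $(<,<_1,+)$-isomorphism with $h(x)=x$ for all $x\in B\cap\alpha$. *)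

theory Defs
  imports Main
begin

section \<open>Ordinals\<close>

text \<open>
  HOL has no type of all ordinals. The type \<open>'a ordinal\<close> is the initial segment of the ordinals
  below the successor cardinal of \<open>max (|'a|, \<aleph>\<^sub>0)\<close>. It contains the order type of every
  well-order on a subset of \<open>'a\<close>, it has no largest element, and suprema of images of proper
  initial segments exist in it (lemma \<open>bdd_above_image_lessThan\<close>), so it is closed under the
  ordinal operations below. As \<open>'a\<close> is arbitrary, a statement about \<open>'a ordinal\<close> speaks about
  arbitrarily large ordinals.
\<close>

definition ordinal_rel :: "'a itself \<Rightarrow> (nat + 'a) set rel" where
  "ordinal_rel _ = cardSuc (card_of (UNIV :: (nat + 'a) set))"

lemma infinite_UNIV_sum: "infinite (UNIV :: (nat + 'a) set)"
  by (metis UNIV_Plus_UNIV finite_Plus_iff infinite_UNIV_nat UNIV_not_empty)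

lemma ordinal_rel_Card_order: "Card_order (ordinal_rel TYPE('a))"
  unfolding ordinal_rel_def by (rule cardSuc_Card_order) (rule card_of_Card_order)

lemma ordinal_rel_infinite: "infinite (Field (ordinal_rel TYPE('a)))"
  unfolding ordinal_rel_def by (simp only: card_of_cardSuc_finite infinite_UNIV_sum not_False_eq_True)

lemma ordinal_rel_regular: "regularCard (ordinal_rel TYPE('a))"
proof -
  have "infinite (Field (card_of (UNIV :: (nat + 'a) set)))"
    by (simp only: Field_card_of infinite_UNIV_sum not_False_eq_True)
  then show ?thesis
    unfolding ordinal_rel_def using card_of_Card_order by (rule infinite_cardSuc_regularCard)
qed

typedef 'a ordinal = "Field (ordinal_rel TYPE('a))"
  using ordinal_rel_infinite[where 'a = 'a] by (metis ex_in_conv finite.emptyI)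

setup_lifting type_definition_ordinal

instantiation ordinal :: (type) linorder
begin

lift_definition less_eq_ordinal :: "'a ordinal \<Rightarrow> 'a ordinal \<Rightarrow> bool"
  is "\<lambda>x y. (x, y) \<in> ordinal_rel TYPE('a)" .

definition less_ordinal :: "'a ordinal \<Rightarrow> 'a ordinal \<Rightarrow> bool" where
  "less_ordinal x y \<longleftrightarrow> x \<le> y \<and> \<not> y \<le> x"

instance
proof -
  have wo: "Well_order (ordinal_rel TYPE('a))"
    using ordinal_rel_Card_order by (rule card_order_on_well_order_on)
  have lo: "Linear_order (ordinal_rel TYPE('a))"
    using wo by (simp add: well_order_on_def)
  have "Total (ordinal_rel TYPE('a))" "Refl (ordinal_rel TYPE('a))"
    using lo by (simp_all add: order_on_defs)
  then have tot: "\<forall>u\<in>Field (ordinal_rel TYPE('a)). \<forall>v\<in>Field (ordinal_rel TYPE('a)).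
      (u, v) \<in> ordinal_rel TYPE('a) \<or> (v, u) \<in> ordinal_rel TYPE('a)"
    unfolding total_on_def refl_on_def by metis
  show "OFCLASS('a ordinal, linorder_class)"
  proof
    fix x y z :: "'a ordinal"
    show "x < y \<longleftrightarrow> x \<le> y \<and> \<not> y \<le> x" by (simp add: less_ordinal_def)
    show "x \<le> x"
      using lo by transfer (auto simp: order_on_defs refl_on_def)
    show "x \<le> z" if "x \<le> y" "y \<le> z"
      using lo that by transfer (auto simp: order_on_defs dest: transD)
    show "x = y" if "x \<le> y" "y \<le> x"
      using lo that by transfer (auto simp: order_on_defs dest: antisymD)
    show "x \<le> y \<or> y \<le> x"
      using tot by transfer blast
  qed
qed

end

lemma less_ordinal_iff:
  "x < y \<longleftrightarrow> (Rep_ordinal x, Rep_ordinal y) \<in> ordinal_rel TYPE('a) - Id" for x y :: "'a ordinal"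
proof -
  have "x < y \<longleftrightarrow> x \<le> y \<and> x \<noteq> y" by auto
  then show ?thesis by (simp add: less_eq_ordinal.rep_eq Rep_ordinal_inject)
qed

instance ordinal :: (type) wellorder
proof (rule wf_wellorderI)
  have "wf (ordinal_rel TYPE('a) - Id)"
    using card_order_on_well_order_on[OF ordinal_rel_Card_order[where 'a = 'a]]
    by (simp add: well_order_on_def)
  then have "wf (inv_image (ordinal_rel TYPE('a) - Id) Rep_ordinal)"
    by (rule wf_inv_image)
  moreover have "{(x, y). x < (y :: 'a ordinal)}
      = inv_image (ordinal_rel TYPE('a) - Id) Rep_ordinal"
    by (auto simp: less_ordinal_iff inv_image_def)
  ultimately show "wf {(x, y). x < (y :: 'a ordinal)}" by simp
qed intro_classes

lemma ordinal_gt_ex: "\<exists>y. x < y" for x :: "'a ordinal"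
proof -
  have "\<exists>b \<in> Field (ordinal_rel TYPE('a)). Rep_ordinal x \<noteq> b \<and> (Rep_ordinal x, b) \<in> ordinal_rel TYPE('a)"
    using ordinal_rel_Card_order ordinal_rel_infinite Rep_ordinal
    by (rule infinite_Card_order_limit)
  then obtain b where "b \<in> Field (ordinal_rel TYPE('a))" "Rep_ordinal x \<noteq> b"
    "(Rep_ordinal x, b) \<in> ordinal_rel TYPE('a)" by blast
  then have "x < Abs_ordinal b"
    by (simp add: less_ordinal_iff Abs_ordinal_inverse)
  then show ?thesis ..
qed

lemma bdd_above_image_lessThan: "bdd_above (f ` {..<b})" for b :: "'a ordinal" and f :: "'a ordinal \<Rightarrow> 'a ordinal"
proof -
  let ?r = "ordinal_rel TYPE('a)"
  let ?K = "Rep_ordinal ` f ` {..<b}"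
  have sub: "?K \<subseteq> Field ?r" using Rep_ordinal by auto
  have lt: "(card_of (underS ?r (Rep_ordinal b)), ?r) \<in> ordLess"
    using ordinal_rel_Card_order Rep_ordinal by (rule card_of_underS)
  have K: "?K = (\<lambda>u. Rep_ordinal (f (Abs_ordinal u))) ` underS ?r (Rep_ordinal b)"
  proof -
    have "underS ?r (Rep_ordinal b) = Rep_ordinal ` {..<b}"
    proof (intro equalityI subsetI)
      fix u assume "u \<in> underS ?r (Rep_ordinal b)"
      then have u: "u \<noteq> Rep_ordinal b" "(u, Rep_ordinal b) \<in> ?r" by (auto simp: underS_def)
      then have "u \<in> Field ?r" by (auto simp: Field_def)
      then have "Rep_ordinal (Abs_ordinal u) = u" by (rule Abs_ordinal_inverse)
      then show "u \<in> Rep_ordinal ` {..<b}"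
        using u by (intro image_eqI[of _ _ "Abs_ordinal u"]) (auto simp: less_ordinal_iff)
    next
      fix u assume "u \<in> Rep_ordinal ` {..<b}"
      then show "u \<in> underS ?r (Rep_ordinal b)" by (auto simp: less_ordinal_iff underS_def)
    qed
    then show ?thesis by (simp only: image_image Rep_ordinal_inverse)
  qed
  have "(card_of ?K, ?r) \<in> ordLess"
    unfolding K using card_of_image lt by (rule ordLeq_ordLess_trans)
  then have "\<not> (card_of ?K, ?r) \<in> ordIso"
    by (rule not_ordLess_ordIso)
  moreover have "cofinal ?K ?r \<Longrightarrow> (card_of ?K, ?r) \<in> ordIso"
    using ordinal_rel_regular[where 'a = 'a, unfolded regularCard_def, rule_format, of ?K] sub
    by (simp only: simp_thms)
  ultimately have nc: "\<not> cofinal ?K ?r" by (rule contrapos_nn)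
  have not_cofinal: "\<exists>a \<in> Field r. \<forall>k \<in> K. a = k \<or> (a, k) \<notin> r" if "\<not> cofinal K r" for K :: "'c set" and r
    using that unfolding cofinal_def by blast
  obtain a where a: "a \<in> Field ?r" "\<And>k. k \<in> ?K \<Longrightarrow> a = k \<or> (a, k) \<notin> ?r"
    using not_cofinal[OF nc] by (elim bexE) (rule that, assumption, erule bspec)
  have "y \<le> Abs_ordinal a" if "y \<in> f ` {..<b}" for y
  proof (rule ccontr)
    assume "\<not> y \<le> Abs_ordinal a"
    then have "Abs_ordinal a < y" by simp
    then have "(a, Rep_ordinal y) \<in> ?r - Id" using a(1) by (simp add: less_ordinal_iff Abs_ordinal_inverse)
    with a(2)[of "Rep_ordinal y"] that show False by auto
  qed
  then show ?thesis by (rule bdd_aboveI)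
qed

instantiation ordinal :: (type) conditionally_complete_linorder
begin

definition inf_ordinal :: "'a ordinal \<Rightarrow> 'a ordinal \<Rightarrow> 'a ordinal" where
  "inf_ordinal = min"

definition sup_ordinal :: "'a ordinal \<Rightarrow> 'a ordinal \<Rightarrow> 'a ordinal" where
  "sup_ordinal = max"

definition Inf_ordinal :: "'a ordinal set \<Rightarrow> 'a ordinal" where
  "Inf_ordinal A = (LEAST x. x \<in> A)"

text \<open>\<open>Sup\<close> is the least upper bound for every bounded set, and \<open>Sup {} = 0\<close>.\<close>

definition Sup_ordinal :: "'a ordinal set \<Rightarrow> 'a ordinal" where
  "Sup_ordinal A = (LEAST z. \<forall>x\<in>A. x \<le> z)"

instance
proof
  fix x y z :: "'a ordinal" and X :: "'a ordinal set"
  show "inf x y \<le> x" "inf x y \<le> y" "x \<le> sup x y" "y \<le> sup x y"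
    by (auto simp: inf_ordinal_def sup_ordinal_def)
  show "x \<le> inf y z" if "x \<le> y" "x \<le> z" using that by (simp add: inf_ordinal_def)
  show "sup y z \<le> x" if "y \<le> x" "z \<le> x" using that by (simp add: sup_ordinal_def)
  show "Inf X \<le> x" if "x \<in> X" "bdd_below X"
    using that by (simp add: Inf_ordinal_def Least_le)
  show "z \<le> Inf X" if "X \<noteq> {}" "\<And>x. x \<in> X \<Longrightarrow> z \<le> x"
    using that unfolding Inf_ordinal_def ex_in_conv[symmetric] by (rule LeastI2_ex)
  show "x \<le> Sup X" if "x \<in> X" "bdd_above X"
  proof -
    from that(2) obtain m where "\<forall>x\<in>X. x \<le> m" by (auto simp: bdd_above_def)
    then have "\<forall>x\<in>X. x \<le> Sup X" unfolding Sup_ordinal_def by (rule LeastI)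
    with that(1) show ?thesis by blast
  qed
  show "Sup X \<le> z" if "X \<noteq> {}" "\<And>x. x \<in> X \<Longrightarrow> x \<le> z"
    using that unfolding Sup_ordinal_def by (intro Least_le) blast
qed

end

lemma ordinal_Sup_upper: "x \<in> X \<Longrightarrow> bdd_above X \<Longrightarrow> x \<le> Sup X" for X :: "'a ordinal set"
  by (rule cSup_upper)

lemma ordinal_Sup_least: "(\<And>x. x \<in> X \<Longrightarrow> x \<le> z) \<Longrightarrow> Sup X \<le> z" for X :: "'a ordinal set"
  unfolding Sup_ordinal_def by (rule Least_le) blast


section \<open>Ordinal arithmetic\<close>

definition osucc :: "'a ordinal \<Rightarrow> 'a ordinal" where
  "osucc x = (LEAST y. x < y)"

instantiation ordinal :: (type) "{zero, one}"
begin

definition zero_ordinal :: "'a ordinal" where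
  "(0 :: 'a ordinal) = (LEAST x. True)"

definition one_ordinal :: "'a ordinal" where
  "(1 :: 'a ordinal) = osucc 0"

instance ..

end

text \<open>Each operation is given by one recursion covering the zero, successor and limit cases;
  the usual three clauses are derived below.\<close>

function oadd :: "'a ordinal \<Rightarrow> 'a ordinal \<Rightarrow> 'a ordinal" where
  [simp del]: "oadd a b = Sup (insert a ((\<lambda>c. osucc (oadd a c)) ` {..<b}))"
  by pat_completeness auto
termination
  by (relation "inv_image {(x, y). x < y} snd") (rule wf_inv_image[OF wf], simp)

instantiation ordinal :: (type) plus
begin

definition plus_ordinal :: "'a ordinal \<Rightarrow> 'a ordinal \<Rightarrow> 'a ordinal" where
  "a + b = oadd a b"

instance ..

end

function otimes :: "'a ordinal \<Rightarrow> 'a ordinal \<Rightarrow> 'a ordinal" where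
  [simp del]: "otimes a b = Sup ((\<lambda>c. otimes a c + a) ` {..<b})"
  by pat_completeness auto
termination
  by (relation "inv_image {(x, y). x < y} snd") (rule wf_inv_image[OF wf], simp)

instantiation ordinal :: (type) times
begin

definition times_ordinal :: "'a ordinal \<Rightarrow> 'a ordinal \<Rightarrow> 'a ordinal" where
  "a * b = otimes a b"

instance ..

end

lemma plus_ordinal_rec: "a + b = Sup (insert a ((\<lambda>c. osucc (a + c)) ` {..<b}))" for a :: "'a ordinal"
  unfolding plus_ordinal_def by (rule oadd.simps)

lemma times_ordinal_rec: "a * b = Sup ((\<lambda>c. a * c + a) ` {..<b})" for a :: "'a ordinal"
  unfolding times_ordinal_def by (rule otimes.simps)

definition omega :: "'a ordinal" where
  "omega = (LEAST x. 0 < x \<and> (\<forall>y<x. osucc y < x))"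

function omega_pow :: "'a ordinal \<Rightarrow> 'a ordinal" where
  "omega_pow b = Sup (insert 1 ((\<lambda>c. omega_pow c * omega) ` {..<b}))"
  by pat_completeness auto
termination
  by (relation "{(x, y). x < y}") (rule wf, simp)

declare omega_pow.simps [simp del]

definition left_diff :: "'a ordinal \<Rightarrow> 'a ordinal \<Rightarrow> 'a ordinal" where
  "left_diff a b = (THE s. a + s = b)"

lemma ordinal_zero_le [simp]: "0 \<le> x" for x :: "'a ordinal"
  unfolding zero_ordinal_def by (rule Least_le) simp

lemma ordinal_not_less_zero [simp]: "\<not> x < 0" for x :: "'a ordinal"
  by (simp add: not_less)

lemma ordinal_lessThan_zero [simp]: "{..<0 :: 'a ordinal} = {}"
  by auto

lemma ordinal_zero_less_iff: "0 < x \<longleftrightarrow> x \<noteq> 0" for x :: "'a ordinal"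
  using ordinal_zero_le[of x] by (auto simp: less_le)

lemma less_osucc [simp]: "x < osucc x"
  unfolding osucc_def using ordinal_gt_ex by (rule LeastI_ex)

lemma osucc_le_iff: "osucc x \<le> y \<longleftrightarrow> x < y"
  by (metis Least_le less_le_trans less_osucc osucc_def)

lemma less_osucc_iff: "x < osucc y \<longleftrightarrow> x \<le> y"
  by (metis osucc_le_iff not_le)

lemma osucc_mono: "x \<le> y \<Longrightarrow> osucc x \<le> osucc y"
  by (simp add: osucc_le_iff less_osucc_iff)

lemma lessThan_osucc: "{..<osucc x} = insert x {..<x}"
  by (auto simp: less_osucc_iff)

definition limit_ordinal :: "'a ordinal \<Rightarrow> bool" where
  "limit_ordinal x \<longleftrightarrow> 0 < x \<and> (\<forall>y<x. osucc y < x)"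

lemma ordinal_cases:
  obtains "x = 0" | y where "x = osucc y" | "limit_ordinal x"
proof -
  have "\<exists>y. x = osucc y" if "x \<noteq> 0" "\<not> limit_ordinal x"
    using that by (metis antisym limit_ordinal_def not_less ordinal_zero_less_iff osucc_le_iff)
  then show thesis using that by blast
qed

lemma add_bdd: "bdd_above (insert a ((\<lambda>c. osucc (a + c)) ` {..<b}))" for a :: "'a ordinal"
  using bdd_above_image_lessThan by simp

lemma add_le_left: "a \<le> a + b" for a :: "'a ordinal"
  unfolding plus_ordinal_rec[of a b] by (rule ordinal_Sup_upper[OF _ add_bdd]) simp

lemma add_strict_mono: "c < b \<Longrightarrow> a + c < a + b" for a :: "'a ordinal"
  unfolding osucc_le_iff[symmetric] plus_ordinal_rec[of a b]
  by (rule ordinal_Sup_upper[OF _ add_bdd]) (simp add: osucc_le_iff)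

lemma add_mono_right: "c \<le> b \<Longrightarrow> a + c \<le> a + b" for a :: "'a ordinal"
  using add_strict_mono[of c b a] by (auto simp: le_less)

lemma add_zero: "a + 0 = a" for a :: "'a ordinal"
  unfolding plus_ordinal_rec[of a 0] by simp

lemma add_osucc: "a + osucc b = osucc (a + b)"
proof (rule antisym)
  show "a + osucc b \<le> osucc (a + b)"
    unfolding plus_ordinal_rec[of a "osucc b"]
  proof (rule ordinal_Sup_least)
    fix x assume "x \<in> insert a ((\<lambda>c. osucc (a + c)) ` {..<osucc b})"
    then consider "x = a" | c where "c \<le> b" "x = osucc (a + c)" by (auto simp: less_osucc_iff)
    then show "x \<le> osucc (a + b)"
    proof cases
      case 1
      then show ?thesis using le_less_trans[OF add_le_left less_osucc, of a b] by simp
    next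
      case 2
      then show ?thesis by (simp add: osucc_mono add_mono_right)
    qed
  qed
  show "osucc (a + b) \<le> a + osucc b" by (simp add: osucc_le_iff add_strict_mono)
qed

lemma osucc_eq_add_one: "osucc a = a + 1"
  unfolding one_ordinal_def by (simp add: add_osucc add_zero)

lemma add_limit: "limit_ordinal b \<Longrightarrow> a + b = Sup ((\<lambda>c. a + c) ` {..<b})"
proof (rule antisym)
  assume b: "limit_ordinal b"
  have bdd: "bdd_above ((\<lambda>c. a + c) ` {..<b})" by (rule bdd_above_image_lessThan)
  have *: "a + c \<le> Sup ((\<lambda>c. a + c) ` {..<b})" if "c < b" for c
    using that by (intro ordinal_Sup_upper[OF _ bdd]) auto
  show "a + b \<le> Sup ((\<lambda>c. a + c) ` {..<b})"
    unfolding plus_ordinal_rec[of a b]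
    by (rule ordinal_Sup_least) (use b *[of 0] * in \<open>auto simp: limit_ordinal_def add_zero add_osucc[symmetric]\<close>)
  show "Sup ((\<lambda>c. a + c) ` {..<b}) \<le> a + b"
    by (rule ordinal_Sup_least) (auto intro: add_mono_right)
qed

lemma add_mono_left: "a \<le> b \<Longrightarrow> a + c \<le> b + c" for a :: "'a ordinal"
proof (induction c rule: less_induct)
  case (less c)
  show ?case unfolding plus_ordinal_rec[of a c]
  proof (rule ordinal_Sup_least)
    fix x assume "x \<in> insert a ((\<lambda>c. osucc (a + c)) ` {..<c})"
    then consider "x = a" | d where "d < c" "x = osucc (a + d)" by auto
    then show "x \<le> b + c"
    proof cases
      case 1
      then show ?thesis using less.prems add_le_left order.trans by blast
    next
      case 2
      then show ?thesis
        using less.IH[OF 2(1) less.prems] add_strict_mono[OF 2(1), of b] by (simp add: osucc_le_iff)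
    qed
  qed
qed

lemma add_le_right: "b \<le> a + b" for a :: "'a ordinal"
proof (induction b rule: less_induct)
  case (less b)
  show ?case
  proof (rule ccontr)
    assume "\<not> b \<le> a + b"
    then have "a + b < b" by simp
    with less[OF this] add_strict_mono[OF this, of a] show False by simp
  qed
qed

lemma zero_add: "0 + b = b" for b :: "'a ordinal"
proof (induction b rule: less_induct)
  case (less b)
  then have "0 + b \<le> b"
    unfolding plus_ordinal_rec[of 0 b] by (intro ordinal_Sup_least) (auto simp: osucc_le_iff)
  then show ?case by (rule antisym) (rule add_le_right)
qed

lemma left_diff_unique:
  fixes a :: "'a ordinal"
  assumes "a \<le> b" shows "\<exists>!s. a + s = b"
proof -
  have inj: "s = s'" if "a + s = a + s'" for s s'
    using that add_strict_mono[of s s' a] add_strict_mono[of s' s a]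
    by (cases s s' rule: linorder_cases) auto
  define s where "s = (LEAST s. b \<le> a + s)"
  have s: "b \<le> a + s" unfolding s_def using add_le_right by (rule LeastI)
  have below: "a + c < b" if "c < s" for c
    using not_less_Least[of c "\<lambda>s. b \<le> a + s"] that by (simp add: s_def)
  have "a + s \<le> b"
    unfolding plus_ordinal_rec[of a s]
    by (rule ordinal_Sup_least) (auto simp: assms osucc_le_iff below)
  with s have "a + s = b" by simp
  then show ?thesis using inj by blast
qed

lemma add_left_diff: "a \<le> b \<Longrightarrow> a + left_diff a b = b"
  unfolding left_diff_def using left_diff_unique by (rule theI')

lemma times_upper: "c < b \<Longrightarrow> a * c + a \<le> a * b" for a :: "'a ordinal"
  unfolding times_ordinal_rec[of a b]
  by (rule ordinal_Sup_upper[OF _ bdd_above_image_lessThan]) simp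

lemma times_mono_right: "c \<le> b \<Longrightarrow> a * c \<le> a * b" for a :: "'a ordinal"
  using times_upper[of c b a] add_le_left[of "a * c" a] by (auto simp: le_less)

lemma times_zero: "a * 0 = 0" for a :: "'a ordinal"
  unfolding times_ordinal_rec[of a 0] by (simp add: Sup_ordinal_def zero_ordinal_def[symmetric])

lemma times_osucc: "a * osucc b = a * b + a"
proof (rule antisym)
  show "a * osucc b \<le> a * b + a"
    unfolding times_ordinal_rec[of a "osucc b"]
    by (rule ordinal_Sup_least) (auto simp: less_osucc_iff intro!: add_mono_left times_mono_right)
  show "a * b + a \<le> a * osucc b" by (simp add: times_upper)
qed

lemma times_limit: "limit_ordinal b \<Longrightarrow> a * b = Sup ((\<lambda>c. a * c) ` {..<b})"
proof (rule antisym)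
  assume b: "limit_ordinal b"
  have bdd: "bdd_above ((\<lambda>c. a * c) ` {..<b})" by (rule bdd_above_image_lessThan)
  show "a * b \<le> Sup ((\<lambda>c. a * c) ` {..<b})"
    unfolding times_ordinal_rec[of a b]
    by (rule ordinal_Sup_least)
      (use b in \<open>auto simp: limit_ordinal_def times_osucc[symmetric] intro!: ordinal_Sup_upper[OF _ bdd]\<close>)
  show "Sup ((\<lambda>c. a * c) ` {..<b}) \<le> a * b"
    by (rule ordinal_Sup_least) (auto intro: times_mono_right)
qed

lemma times_mono_left: "a \<le> b \<Longrightarrow> a * c \<le> b * c" for a :: "'a ordinal"
proof (induction c rule: less_induct)
  case (less c)
  show ?case unfolding times_ordinal_rec[of a c]
  proof (rule ordinal_Sup_least)
    fix x assume "x \<in> (\<lambda>c. a * c + a) ` {..<c}"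
    then obtain d where d: "d < c" "x = a * d + a" by auto
    have "a * d + a \<le> b * d + b"
      using less.IH[OF d(1) less.prems] less.prems
      by (meson add_mono_left add_mono_right order.trans)
    also have "\<dots> \<le> b * c" using d(1) by (rule times_upper)
    finally show "x \<le> b * c" by (simp only: d(2))
  qed
qed

lemma ex_limit_ordinal: "\<exists>x :: 'a ordinal. limit_ordinal x"
proof -
  define f :: "nat \<Rightarrow> 'a ordinal" where "f n = (osucc ^^ n) 0" for n
  have "\<exists>z. \<forall>n. f n < z"
  proof (rule ccontr)
    assume "\<not> ?thesis"
    then have unb: "\<exists>n. z \<le> f n" for z by (simp add: not_less)
    have fin: "finite {..f n}" for n
    proof (induction n)
      case 0
      have "{..f 0} = {0}" by (auto simp: f_def antisym)
      then show ?case by simp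
    next
      case (Suc n)
      have "{..f (Suc n)} = insert (f (Suc n)) {..f n}"
        by (auto simp: f_def less_osucc_iff le_less)
      with Suc show ?case by simp
    qed
    let ?r = "ordinal_rel TYPE('a)"
    have un: "(UNIV :: 'a ordinal set) = (\<Union>n. {..f n})" using unb by auto
    have "(card_of (\<Union>n. {..f n}), card_of (UNIV :: nat set)) \<in> ordLeq"
    proof (rule card_of_UNION_ordLeq_infinite)
      show "(card_of (UNIV :: nat set), card_of (UNIV :: nat set)) \<in> ordLeq" by (rule card_of_mono1) simp
      show "\<forall>n\<in>UNIV. (card_of {..f n}, card_of (UNIV :: nat set)) \<in> ordLeq"
      proof
        fix n
        obtain g :: "'a ordinal \<Rightarrow> nat" where "inj_on g {..f n}"
          using finite_imp_inj_to_nat_seg[OF fin] by metis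
        then show "(card_of {..f n}, card_of (UNIV :: nat set)) \<in> ordLeq"
          using card_of_ordLeq[of "{..f n}" "UNIV :: nat set"] by blast
      qed
    qed simp
    then have le_nat: "(card_of (UNIV :: 'a ordinal set), card_of (UNIV :: nat set)) \<in> ordLeq"
      by (simp only: un)
    have less: "(card_of (UNIV :: (nat + 'a) set), ?r) \<in> ordLess"
      unfolding ordinal_rel_def by (rule cardSuc_greater) (rule card_of_Card_order)
    have "(card_of (UNIV :: nat set), card_of (UNIV :: (nat + 'a) set)) \<in> ordLeq"
      using card_of_Plus1[of "UNIV :: nat set" "UNIV :: 'a set"] by (simp only: UNIV_Plus_UNIV)
    with le_nat have "(card_of (UNIV :: 'a ordinal set), ?r) \<in> ordLess"
      using less ordLeq_transitive ordLeq_ordLess_trans by blast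
    moreover have "(card_of (Field ?r), card_of (UNIV :: 'a ordinal set)) \<in> ordLeq"
      unfolding type_definition.Rep_range[OF type_definition_ordinal, symmetric] by (rule card_of_image)
    ultimately have "(card_of (Field ?r), ?r) \<in> ordLess" by (rule ordLeq_ordLess_trans[rotated])
    moreover have "(card_of (Field ?r), ?r) \<in> ordIso"
      using ordinal_rel_Card_order by (rule card_of_Field_ordIso)
    ultimately show False using not_ordLess_ordIso by blast
  qed
  then have ex: "\<exists>z. \<forall>n. f n < z" .
  define l where "l = (LEAST z. \<forall>n. f n < z)"
  have l: "f n < l" for n unfolding l_def using LeastI_ex[OF ex] by blast
  have "osucc y < l" if "y < l" for y
  proof -
    from not_less_Least[OF that[unfolded l_def]] obtain n where "y \<le> f n" by (auto simp: not_less)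
    then have "osucc y \<le> f (Suc n)" by (simp add: f_def osucc_mono)
    then show ?thesis using l by (rule le_less_trans)
  qed
  moreover have "0 < l" using l[of 0] by (simp add: f_def)
  ultimately show ?thesis unfolding limit_ordinal_def by blast
qed

lemma omega_limit: "limit_ordinal omega"
  using LeastI_ex[OF ex_limit_ordinal] unfolding limit_ordinal_def omega_def .

lemma omega_least: "limit_ordinal x \<Longrightarrow> omega \<le> x"
  unfolding limit_ordinal_def omega_def by (rule Least_le)

lemma omega_pow_bdd: "bdd_above (insert 1 ((\<lambda>c. omega_pow c * omega) ` {..<b}))"
  using bdd_above_image_lessThan by simp

lemma omega_pow_mono: "c \<le> b \<Longrightarrow> omega_pow c \<le> omega_pow b"
proof -
  assume "c \<le> b"
  then have "insert 1 ((\<lambda>c. omega_pow c * omega) ` {..<c}) \<subseteq> insert 1 ((\<lambda>c. omega_pow c * omega) ` {..<b})"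
    by auto
  then show ?thesis
    unfolding omega_pow.simps[of b] omega_pow.simps[of c]
    by (intro cSup_subset_mono omega_pow_bdd) auto
qed

lemma omega_pow_zero: "omega_pow 0 = 1"
  unfolding omega_pow.simps[of 0] by simp

lemma omega_pow_osucc: "omega_pow (osucc b) = omega_pow b * omega" for b :: "'a ordinal"
proof (rule antisym)
  have "1 \<le> omega_pow b"
    using omega_pow_mono[of 0 b] by (simp add: omega_pow_zero)
  moreover have "omega_pow b \<le> omega_pow b * omega"
  proof -
    have "0 < (omega :: 'a ordinal)" using omega_limit[where 'a = 'a] by (simp add: limit_ordinal_def)
    from times_upper[OF this, of "omega_pow b"] show ?thesis by (simp add: times_zero zero_add)
  qed
  ultimately show "omega_pow (osucc b) \<le> omega_pow b * omega"
    unfolding omega_pow.simps[of "osucc b"]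
    by (intro ordinal_Sup_least) (auto simp: less_osucc_iff intro!: times_mono_left omega_pow_mono)
  show "omega_pow b * omega \<le> omega_pow (osucc b)"
    unfolding omega_pow.simps[of "osucc b"]
    by (rule ordinal_Sup_upper[OF _ omega_pow_bdd]) simp
qed

lemma omega_pow_limit: "limit_ordinal b \<Longrightarrow> omega_pow b = Sup (omega_pow ` {..<b})"
proof (rule antisym)
  assume b: "limit_ordinal b"
  have bdd: "bdd_above (omega_pow ` {..<b})" by (rule bdd_above_image_lessThan)
  have *: "omega_pow c \<le> Sup (omega_pow ` {..<b})" if "c < b" for c
    using that by (intro ordinal_Sup_upper[OF _ bdd]) auto
  show "omega_pow b \<le> Sup (omega_pow ` {..<b})"
    unfolding omega_pow.simps[of b]
    by (rule ordinal_Sup_least)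
      (use b *[of 0] * in \<open>auto simp: limit_ordinal_def omega_pow_zero omega_pow_osucc[symmetric]\<close>)
  show "Sup (omega_pow ` {..<b}) \<le> omega_pow b"
    by (rule ordinal_Sup_least) (auto intro: omega_pow_mono)
qed

lemma division_unique:
  fixes \<alpha> :: "'a ordinal"
  assumes "\<alpha> * n + l = \<alpha> * m + k" "l < \<alpha>" "k < \<alpha>"
  shows "n = m \<and> l = k"
proof -
  have lt: "\<alpha> * n + l < \<alpha> * m + k" if "n < m" "l < \<alpha>" for n m l k
    using add_strict_mono[OF that(2), of "\<alpha> * n"] times_upper[OF that(1), of \<alpha>] add_le_left[of "\<alpha> * m" k]
    by simp
  have "n = m" using lt[of n m l k] lt[of m n k l] assms by (cases n m rule: linorder_cases) auto
  then show ?thesis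
    using assms add_strict_mono[of l k "\<alpha> * n"] add_strict_mono[of k l "\<alpha> * n"]
    by (cases l k rule: linorder_cases) auto
qed


section \<open>The relations \<open><\<^sub>1\<close> and \<open><\<^sup>0\<close>\<close>

definition Class0 :: "'a ordinal set" where
  "Class0 = {omega_pow c | c. 0 < c}"

definition Lim :: "'a ordinal set \<Rightarrow> 'a ordinal set" where
  "Lim A = {a. a \<noteq> 0 \<and> a = Sup (A \<inter> {..<a})}"

definition is_iso ::
  "('a ordinal \<Rightarrow> 'a ordinal \<Rightarrow> bool) \<Rightarrow> ('a ordinal \<Rightarrow> 'a ordinal) \<Rightarrow> 'a ordinal set \<Rightarrow> 'a ordinal set \<Rightarrow> bool"
where
  "is_iso R h Z Z' \<longleftrightarrow> bij_betw h Z Z' \<and>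
    (\<forall>a\<in>Z. \<forall>b\<in>Z.
      (a < b \<longleftrightarrow> h a < h b) \<and>
      (R a b \<longleftrightarrow> R (h a) (h b)) \<and>
      (a + b \<in> Z \<longleftrightarrow> h a + h b \<in> Z') \<and>
      (a + b \<in> Z \<longrightarrow> h (a + b) = h a + h b))"

lemma is_iso_cong [fundef_cong]:
  assumes "h = h'" "Z = W" "Z' = W'"
    "\<And>a b. a \<in> W \<union> W' \<Longrightarrow> b \<in> W \<union> W' \<Longrightarrow> R a b = R' a b"
  shows "is_iso R h Z Z' = is_iso R' h' W W'"
proof -
  have "R a b = R' a b \<and> R (h' a) (h' b) = R' (h' a) (h' b)"
    if "bij_betw h' W W'" "a \<in> W" "b \<in> W" for a b
    using that assms(4) by (simp add: bij_betwE)
  then show ?thesis unfolding is_iso_def assms(1-3) by auto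
qed

declare conj_cong [fundef_cong]

function less1 :: "'a ordinal \<Rightarrow> 'a ordinal \<Rightarrow> bool" (infix "<\<^sub>1" 50) where
  "a <\<^sub>1 b \<longleftrightarrow> a < b \<and>
    (\<forall>Z. finite Z \<and> Z \<subseteq> {..<b} \<longrightarrow>
      (\<exists>Z' h. finite Z' \<and> Z' \<subseteq> {..<a} \<and>
        is_iso (<\<^sub>1) h Z Z' \<and> (\<forall>x \<in> Z \<inter> {..<a}. h x = x)))"
  by pat_completeness auto
termination
  by (relation "inv_image {(x, y). x < y} snd") (rule wf_inv_image[OF wf], auto)

declare conj_cong [fundef_cong del] less1.simps [simp del]

definition le1 :: "'a ordinal \<Rightarrow> 'a ordinal \<Rightarrow> bool" (infix "\<le>\<^sub>1" 50) where
  "a \<le>\<^sub>1 b \<longleftrightarrow> a <\<^sub>1 b \<or> a = b"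

definition g0_up :: "'a ordinal \<Rightarrow> 'a ordinal \<Rightarrow> 'a ordinal \<Rightarrow> 'a ordinal" where
  "g0_up \<alpha> c x = (if x < \<alpha> then x
    else (THE y. \<exists>n l. 1 \<le> n \<and> n < omega \<and> l < \<alpha> \<and> x = \<alpha> * n + l \<and> y = c * n + l))"

text \<open>\<open>g0 \<alpha> c x\<close> is only meaningful for \<open>x\<close> in the domain of \<open>g(0,\<alpha>,c)\<close>: this is \<open>\<alpha>\<omega>\<close> if
  \<open>\<alpha> \<le> c\<close>, and the image of \<open>g(0,c,\<alpha>)\<close> if \<open>c < \<alpha>\<close>.\<close>

definition g0 :: "'a ordinal \<Rightarrow> 'a ordinal \<Rightarrow> 'a ordinal \<Rightarrow> 'a ordinal" where
  "g0 \<alpha> c = (if \<alpha> \<le> c then g0_up \<alpha> c else inv_into {..<c * omega} (g0_up c \<alpha>))"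

definition T0 :: "'a ordinal \<Rightarrow> 'a ordinal \<Rightarrow> 'a ordinal set" where
  "T0 \<alpha> t = (if t < \<alpha> then {t}
    else {t} \<union> {left_diff (\<alpha> * n) t | n. 1 \<le> n \<and> n < omega \<and> t \<in> {\<alpha> * n..<\<alpha> * n + \<alpha>}})"

text \<open>The relation is only used for \<open>\<alpha> \<in> Class0\<close> and \<open>\<alpha> \<le> t \<le> \<alpha> * omega\<close>. Then the first condition
  on \<open>\<delta>\<close> puts every element of \<open>B\<close> into the domain of \<open>g(0,\<alpha>,\<delta>)\<close>.\<close>

definition less_up0 :: "'a ordinal \<Rightarrow> 'a ordinal \<Rightarrow> bool" (infix "<\<^sup>0" 50) where
  "\<alpha> <\<^sup>0 t \<longleftrightarrow> \<alpha> < t \<and>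
    (\<forall>B. finite B \<and> B \<subseteq> {..<t} \<longrightarrow>
      (\<exists>\<delta> \<in> Class0 \<inter> {..<\<alpha>}.
        (\<Union>q\<in>B. T0 \<alpha> q) \<inter> {..<\<alpha>} \<subseteq> {..<\<delta>} \<and>
        is_iso (<\<^sub>1) (g0 \<alpha> \<delta>) B (g0 \<alpha> \<delta> ` B) \<and>
        (\<forall>x \<in> B \<inter> {..<\<alpha>}. g0 \<alpha> \<delta> x = x)))"

lemma division_exists:
  fixes \<alpha> :: "'a ordinal"
  assumes "0 < \<alpha>" "x < \<alpha> * omega"
  obtains n l where "n < omega" "l < \<alpha>" "x = \<alpha> * n + l"
proof -
  define m where "m = (LEAST m. x < \<alpha> * m)"
  have m: "x < \<alpha> * m" and mo: "m \<le> omega"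
    unfolding m_def using assms(2) by (rule LeastI, rule Least_le)
  have below: "\<alpha> * k \<le> x" if "k < m" for k
    using not_less_Least[of k "\<lambda>m. x < \<alpha> * m"] that by (simp add: m_def not_less)
  show thesis
  proof (cases m rule: ordinal_cases)
    case 1
    with m show thesis by (simp add: times_zero)
  next
    case (2 n)
    then have le: "\<alpha> * n \<le> x" and n: "n < omega" using below[of n] mo by (auto simp: osucc_le_iff)
    have eq: "\<alpha> * n + left_diff (\<alpha> * n) x = x" by (rule add_left_diff[OF le])
    have "x < \<alpha> * n + \<alpha>" using m 2 by (simp add: times_osucc)
    then have "left_diff (\<alpha> * n) x < \<alpha>"
      using eq add_mono_right[of \<alpha> "left_diff (\<alpha> * n) x" "\<alpha> * n"] by (metis not_le)
    with n eq show thesis using that by metis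
  next
    case 3
    then have "\<alpha> * m \<le> x"
      unfolding times_limit[OF 3] by (intro ordinal_Sup_least) (auto simp: below)
    with m show thesis by simp
  qed
qed

lemma g0_up_eq:
  assumes "1 \<le> n" "n < omega" "l < \<alpha>"
  shows "g0_up \<alpha> c (\<alpha> * n + l) = c * n + l"
proof -
  have "0 < n" using assms(1) by (simp add: one_ordinal_def osucc_le_iff)
  then have "\<alpha> \<le> \<alpha> * n + l"
    using times_upper[of 0 n \<alpha>] add_le_left[of "\<alpha> * n" l] by (simp add: times_zero zero_add)
  moreover have "(THE y. \<exists>n' l'. 1 \<le> n' \<and> n' < omega \<and> l' < \<alpha> \<and> \<alpha> * n + l = \<alpha> * n' + l' \<and> y = c * n' + l') = c * n + l"
    by (rule the_equality) (use assms division_unique[of \<alpha> n l] in blast)+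
  ultimately show ?thesis by (simp only: g0_up_def leD if_False)
qed

lemma T0_eq:
  assumes "1 \<le> n" "n < omega" "l < \<alpha>"
  shows "T0 \<alpha> (\<alpha> * n + l) = {\<alpha> * n + l, l}"
proof -
  let ?t = "\<alpha> * n + l"
  have "0 < n" using assms(1) by (simp add: one_ordinal_def osucc_le_iff)
  then have ge: "\<alpha> \<le> ?t"
    using times_upper[of 0 n \<alpha>] add_le_left[of "\<alpha> * n" l] by (simp add: times_zero zero_add)
  have mem: "?t \<in> {\<alpha> * n..<\<alpha> * n + \<alpha>}" using assms(3) by (simp add: add_le_left add_strict_mono)
  have eq: "n' = n \<and> left_diff (\<alpha> * n') ?t = l" if "?t \<in> {\<alpha> * n'..<\<alpha> * n' + \<alpha>}" for n'
  proof -
    have e: "\<alpha> * n' + left_diff (\<alpha> * n') ?t = ?t" using that by (intro add_left_diff) simp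
    have "left_diff (\<alpha> * n') ?t < \<alpha>"
    proof (rule ccontr)
      assume "\<not> left_diff (\<alpha> * n') ?t < \<alpha>"
      then have "\<alpha> * n' + \<alpha> \<le> ?t" using e add_mono_right[of \<alpha> "left_diff (\<alpha> * n') ?t" "\<alpha> * n'"] by simp
      with that show False by (simp add: leD)
    qed
    with division_unique[OF e _ assms(3)] show ?thesis by blast
  qed
  have "{left_diff (\<alpha> * n') ?t | n'. 1 \<le> n' \<and> n' < omega \<and> ?t \<in> {\<alpha> * n'..<\<alpha> * n' + \<alpha>}} = {l}"
  proof (intro equalityI subsetI)
    fix y assume "y \<in> {left_diff (\<alpha> * n') ?t | n'. 1 \<le> n' \<and> n' < omega \<and> ?t \<in> {\<alpha> * n'..<\<alpha> * n' + \<alpha>}}"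
    then show "y \<in> {l}" using eq by blast
  next
    fix y assume "y \<in> {l}"
    then show "y \<in> {left_diff (\<alpha> * n') ?t | n'. 1 \<le> n' \<and> n' < omega \<and> ?t \<in> {\<alpha> * n'..<\<alpha> * n' + \<alpha>}}"
      using eq[OF mem] assms mem by (auto intro!: exI[of _ n])
  qed
  then show ?thesis unfolding T0_def using leD[OF ge] by (simp only: if_False Un_insert_left Un_empty_left)
qed

end

theory Submission
  imports Defs
begin

text \<open>
  Applied to finite sets \<open>B \<subset> t\<close>, the hypothesis yields \<open>\<alpha> \<le>\<^sub>1 t\<close>, because \<open>g(0,\<alpha>,\<delta>)\<close> takes its
  values in \<open>\<delta>\<omega> \<le> \<alpha>\<close>. Given \<open>\<gamma> < \<alpha>\<close>, apply it once more to \<open>B = {\<gamma>, \<alpha>, t}\<close>: the resulting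
  isomorphism sends \<open>\<alpha>\<close> to some \<open>\<delta>\<close> with \<open>\<gamma> < \<delta> < \<alpha>\<close> and \<open>t\<close> to \<open>g(0,\<alpha>,\<delta>)(t)\<close>, hence carries
  \<open>\<alpha> \<le>\<^sub>1 t\<close> over to \<open>\<delta> \<le>\<^sub>1 g(0,\<alpha>,\<delta>)(t)\<close>. So these \<open>\<delta>\<close> are cofinal in \<open>\<alpha>\<close>.
\<close>

lemma times_one: "a * 1 = a" for a :: "'a ordinal"
  by (simp add: one_ordinal_def times_osucc times_zero zero_add)

lemma one_le_iff: "1 \<le> n \<longleftrightarrow> n \<noteq> 0" for n :: "'a ordinal"
  by (simp add: one_ordinal_def osucc_le_iff ordinal_zero_less_iff)

lemma one_less_omega: "1 < omega"
  using omega_limit by (auto simp: limit_ordinal_def one_ordinal_def)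

lemma Class0_pos: "\<alpha> \<in> Class0 \<Longrightarrow> 0 < \<alpha>"
  using omega_pow_mono[OF ordinal_zero_le]
  by (auto simp: Class0_def omega_pow_zero one_le_iff ordinal_zero_less_iff)

text \<open>Passing to exponents, \<delta> < \<alpha> means \<open>d < c\<close>, hence
  \<open>osucc d \<le> c\<close>; and raising an exponent by one multiplies the power by
  \<open>omega\<close>.\<close>

lemma Class0_times_omega_le:
  assumes "\<delta> \<in> Class0" "\<alpha> \<in> Class0" "\<delta> < \<alpha>"
  shows "\<delta> * omega \<le> \<alpha>"
proof -
  obtain c d where "\<alpha> = omega_pow c" "\<delta> = omega_pow d"
    using assms(1,2) by (auto simp: Class0_def)
  moreover from this have "osucc d \<le> c"
    using assms(3) omega_pow_mono[of c d] by (metis leD leI osucc_le_iff)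
  ultimately show ?thesis
    using omega_pow_mono[of "osucc d" c] by (simp add: omega_pow_osucc)
qed

lemma times_add_less_times_omega:
  fixes \<delta> :: "'a ordinal"
  assumes "n < omega" "l < \<delta>"
  shows "\<delta> * n + l < \<delta> * omega"
  using add_strict_mono[OF assms(2)] times_upper[OF assms(1)] by (rule less_le_trans)

lemma division_cases:
  fixes \<alpha> :: "'a ordinal"
  assumes "0 < \<alpha>" "x < \<alpha> * omega"
  obtains "x < \<alpha>" | n l where "1 \<le> n" "n < omega" "l < \<alpha>" "x = \<alpha> * n + l"
proof -
  obtain n l where "n < omega" "l < \<alpha>" "x = \<alpha> * n + l"
    using assms by (rule division_exists)
  then show thesis
    by (cases "n = 0") (auto simp: times_zero zero_add one_le_iff intro: that)
qed

text \<open>Downwards, \<open>g0\<close> is a choice of preimage under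
  \<open>g0_up \<delta> \<alpha>\<close>. One preimage of \<alpha> is \<delta> = \<delta> * 1 + 0,
  and uniqueness of division by \<alpha> excludes every other.\<close>

lemma g0_at_base:
  assumes "\<delta> \<in> Class0" "\<delta> < \<alpha>"
  shows "g0 \<alpha> \<delta> \<alpha> = \<delta>"
proof -
  let ?y = "inv_into {..<\<delta> * omega} (g0_up \<delta> \<alpha>) \<alpha>"
  have pos: "0 < \<delta>" using assms(1) by (rule Class0_pos)
  have "g0_up \<delta> \<alpha> \<delta> = \<alpha>"
    using g0_up_eq[OF order.refl one_less_omega pos, of \<alpha>] by (simp add: times_one add_zero)
  moreover have "\<delta> < \<delta> * omega"
    using times_add_less_times_omega[OF one_less_omega pos] by (simp add: times_one add_zero)
  ultimately have im: "\<alpha> \<in> g0_up \<delta> \<alpha> ` {..<\<delta> * omega}"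
    by (metis imageI lessThan_iff)
  have eq: "g0_up \<delta> \<alpha> ?y = \<alpha>" using im by (rule f_inv_into_f)
  have "?y < \<delta> * omega" using inv_into_into[OF im] by simp
  with pos have "?y = \<delta>"
  proof (cases rule: division_cases)
    \<comment> \<open>Below \<delta> the map \<open>g0_up \<delta> \<alpha>\<close> is the identity,
      so \<open>?y\<close> would equal \<alpha>, which exceeds \<delta>.\<close>
    case 1
    then show ?thesis using eq assms(2) by (simp add: g0_up_def)
  next
    case (2 n l)
    have "\<alpha> * n + l = \<alpha> * 1 + 0"
      using eq 2 g0_up_eq[of n l \<delta> \<alpha>] by (simp add: times_one add_zero)
    then have "n = 1 \<and> l = 0"
      by (rule division_unique) (use 2 pos assms(2) in auto)
    with 2 show ?thesis by (simp add: times_one add_zero)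
  qed
  then show ?thesis using assms(2) by (auto simp: g0_def)
qed

text \<open>The condition on \<open>T0\<close> bounds the remainder of \<open>x\<close> modulo
  \<alpha> by \<delta>, which puts \<open>x\<close> into the image of
  \<open>g0_up \<delta> \<alpha>\<close>. Only there does \<open>inv_into\<close> return a point of
  the domain \<delta> * \<open>omega\<close>.\<close>

lemma g0_down_less:
  assumes "\<delta> \<in> Class0" "\<delta> < \<alpha>" "x < \<alpha> * omega" "T0 \<alpha> x \<inter> {..<\<alpha>} \<subseteq> {..<\<delta>}"
  shows "g0 \<alpha> \<delta> x < \<delta> * omega"
proof -
  have "x \<in> g0_up \<delta> \<alpha> ` {..<\<delta> * omega}"
  proof -
    have "0 < \<alpha>" using Class0_pos[OF assms(1)] assms(2) by simp
    from this assms(3) show ?thesis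
    proof (cases rule: division_cases)
      case 1
      then have "x < \<delta>" using assms(4) by (auto simp: T0_def)
      moreover have "\<delta> \<le> \<delta> * omega"
        using times_mono_right[OF less_imp_le[OF one_less_omega], of \<delta>] by (simp add: times_one)
      ultimately show ?thesis by (intro image_eqI[of _ _ x]) (auto simp: g0_up_def)
    next
      case (2 n l)
      then have l: "l < \<delta>" using assms(4) by (auto simp: T0_eq)
      with 2 show ?thesis
        by (intro image_eqI[of _ _ "\<delta> * n + l"]) (auto simp: g0_up_eq times_add_less_times_omega)
    qed
  qed
  from inv_into_into[OF this] show ?thesis using assms(2) by (auto simp: g0_def)
qed

lemma less_up0E:
  assumes "\<alpha> <\<^sup>0 t" "finite B" "B \<subseteq> {..<t}"
  obtains \<delta> where "\<delta> \<in> Class0" "\<delta> < \<alpha>" "(\<Union>q\<in>B. T0 \<alpha> q) \<inter> {..<\<alpha>} \<subseteq> {..<\<delta>}"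
    "is_iso (<\<^sub>1) (g0 \<alpha> \<delta>) B (g0 \<alpha> \<delta> ` B)" "\<forall>x \<in> B \<inter> {..<\<alpha>}. g0 \<alpha> \<delta> x = x"
  using assms unfolding less_up0_def by blast

text \<open>The bound \<open>s\<close> is kept apart from \<open>t\<close> since the theorem assumes
  the relation at \<open>t + 1\<close> but needs \<open><\<^sub>1\<close> at \<open>t\<close>: a
  finite subset of \<open>t\<close> is also one of \<open>s\<close>.\<close>

lemma less_up0_imp_less1:
  assumes "\<alpha> \<in> Class0" "\<alpha> <\<^sup>0 s" "\<alpha> < t" "t \<le> s" "t \<le> \<alpha> * omega"
  shows "\<alpha> <\<^sub>1 t"
proof -
  have "\<exists>Z' h. finite Z' \<and> Z' \<subseteq> {..<\<alpha>} \<and> is_iso (<\<^sub>1) h Z Z' \<and> (\<forall>x \<in> Z \<inter> {..<\<alpha>}. h x = x)"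
    if Z: "finite Z" "Z \<subseteq> {..<t}" for Z
  proof -
    have "Z \<subseteq> {..<s}" using Z(2) assms(4) by auto
    then obtain \<delta> where \<delta>: "\<delta> \<in> Class0" "\<delta> < \<alpha>" "(\<Union>q\<in>Z. T0 \<alpha> q) \<inter> {..<\<alpha>} \<subseteq> {..<\<delta>}"
      "is_iso (<\<^sub>1) (g0 \<alpha> \<delta>) Z (g0 \<alpha> \<delta> ` Z)" "\<forall>x \<in> Z \<inter> {..<\<alpha>}. g0 \<alpha> \<delta> x = x"
      by (rule less_up0E[OF assms(2) Z(1)])
    have "g0 \<alpha> \<delta> x < \<alpha>" if "x \<in> Z" for x
    proof -
      have "x < \<alpha> * omega" using that Z(2) assms(5) by auto
      moreover have "T0 \<alpha> x \<inter> {..<\<alpha>} \<subseteq> {..<\<delta>}" using that \<delta>(3) by blast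
      ultimately have "g0 \<alpha> \<delta> x < \<delta> * omega" using \<delta>(1,2) by (intro g0_down_less)
      also have "\<dots> \<le> \<alpha>" using \<delta>(1) assms(1) \<delta>(2) by (rule Class0_times_omega_le)
      finally show ?thesis .
    qed
    then have "g0 \<alpha> \<delta> ` Z \<subseteq> {..<\<alpha>}" by auto
    with Z(1) \<delta>(4,5) show ?thesis by (meson finite_imageI)
  qed
  then show ?thesis unfolding less1.simps[of \<alpha> t] using assms(3) by blast
qed

lemma Lim_iff_cofinal: "\<alpha> \<in> Lim A \<longleftrightarrow> \<alpha> \<noteq> 0 \<and> (\<forall>\<gamma><\<alpha>. \<exists>\<delta>\<in>A. \<gamma> < \<delta> \<and> \<delta> < \<alpha>)"
proof -
  have bdd: "bdd_above (A \<inter> {..<\<alpha>})" by (rule bdd_aboveI[of _ \<alpha>]) auto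
  have le: "Sup (A \<inter> {..<\<alpha>}) \<le> \<alpha>" by (rule ordinal_Sup_least) auto
  have "\<exists>\<delta>\<in>A. \<gamma> < \<delta> \<and> \<delta> < \<alpha>" if "\<alpha> = Sup (A \<inter> {..<\<alpha>})" "\<gamma> < \<alpha>" for \<gamma>
  proof (rule ccontr)
    assume "\<not> ?thesis"
    then have "Sup (A \<inter> {..<\<alpha>}) \<le> \<gamma>" by (intro ordinal_Sup_least) (auto simp: not_less)
    with that show False by simp
  qed
  moreover have "\<alpha> = Sup (A \<inter> {..<\<alpha>})" if cof: "\<forall>\<gamma><\<alpha>. \<exists>\<delta>\<in>A. \<gamma> < \<delta> \<and> \<delta> < \<alpha>"
  proof (rule ccontr)
    assume "\<alpha> \<noteq> Sup (A \<inter> {..<\<alpha>})"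
    \<comment> \<open>Cofinality, applied with this supremum as \<gamma>, yields an element of the
      set above its own supremum.\<close>
    with le have "Sup (A \<inter> {..<\<alpha>}) < \<alpha>" by simp
    then obtain \<delta> where "\<delta> \<in> A \<inter> {..<\<alpha>}" "Sup (A \<inter> {..<\<alpha>}) < \<delta>"
      using cof by blast
    with ordinal_Sup_upper[OF _ bdd] show False by (meson leD)
  qed
  ultimately show ?thesis unfolding Lim_def mem_Collect_eq by blast
qed

theorem proposition12:
  fixes \<alpha> t :: "'a ordinal"
  assumes "\<alpha> \<in> Class0"
    and "t \<in> {\<alpha>..<\<alpha> * omega}"
    and "\<alpha> <\<^sup>0 t + 1"
  shows "\<alpha> \<in> Lim {\<beta> \<in> Class0. T0 \<alpha> t \<inter> {..<\<alpha>} \<subseteq> {..<\<beta>} \<and> \<beta> \<le>\<^sub>1 g0 \<alpha> \<beta> t}"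
proof -
  have "t < t + 1" by (simp add: osucc_eq_add_one[symmetric])
  have "\<exists>\<delta>\<in>{\<beta> \<in> Class0. T0 \<alpha> t \<inter> {..<\<alpha>} \<subseteq> {..<\<beta>} \<and> \<beta> \<le>\<^sub>1 g0 \<alpha> \<beta> t}. \<gamma> < \<delta> \<and> \<delta> < \<alpha>"
    if "\<gamma> < \<alpha>" for \<gamma>
  proof -
    have "finite {\<gamma>, \<alpha>, t}" "{\<gamma>, \<alpha>, t} \<subseteq> {..<t + 1}"
      using that assms(2) \<open>t < t + 1\<close> by auto
    then obtain \<delta> where \<delta>: "\<delta> \<in> Class0" "\<delta> < \<alpha>"
      and T: "(\<Union>q\<in>{\<gamma>, \<alpha>, t}. T0 \<alpha> q) \<inter> {..<\<alpha>} \<subseteq> {..<\<delta>}"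
      and iso: "is_iso (<\<^sub>1) (g0 \<alpha> \<delta>) {\<gamma>, \<alpha>, t} (g0 \<alpha> \<delta> ` {\<gamma>, \<alpha>, t})"
      by (rule less_up0E[OF assms(3)])
    \<comment> \<open>The point \<gamma> joins the finite set so that the bound on the sets
      \<open>T0\<close> forces \<gamma> < \<delta>.\<close>
    have "\<gamma> \<in> T0 \<alpha> \<gamma>" using that by (simp add: T0_def)
    then have "\<gamma> < \<delta>" using T that by blast
    moreover have "T0 \<alpha> t \<inter> {..<\<alpha>} \<subseteq> {..<\<delta>}" using T by blast
    moreover have "\<delta> \<le>\<^sub>1 g0 \<alpha> \<delta> t"
    \<comment> \<open>If \<open>t\<close> is \<alpha> itself, then \<open><\<^sub>1\<close> cannot
      hold between them and the equality in \<open>\<le>\<^sub>1\<close> is used: both sides are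
      \<delta>.\<close>
    proof (cases "t = \<alpha>")
      case True
      then show ?thesis using \<delta> by (simp add: le1_def g0_at_base)
    next
      case False
      then have "\<alpha> <\<^sub>1 t"
        using assms \<open>t < t + 1\<close> by (intro less_up0_imp_less1[of \<alpha> "t + 1"]) auto
      then have "g0 \<alpha> \<delta> \<alpha> <\<^sub>1 g0 \<alpha> \<delta> t" using iso by (auto simp: is_iso_def)
      then show ?thesis using \<delta> by (simp add: le1_def g0_at_base)
    qed
    ultimately show ?thesis using \<delta> by blast
  qed
  moreover have "\<alpha> \<noteq> 0" using Class0_pos[OF assms(1)] by simp
  ultimately show ?thesis unfolding Lim_iff_cofinal by blast
qed

end
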